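(* Let $E/\mathbb{Q}$ be the elliptic curve $y^2=x^3-11x-14$ (Cremona label 32a3). Then $\mathbb{Q}(\zeta_{2^{n+1}})\subseteq \mathbb{Q}(E[2^n])$ for all integers $n>1$.
   Context: For an integer $N\geq 1$, $\mathbb{Q}(E[N])$ denotes the $N$-th division field of $E$, i.e. the field generated over $\mathbb{Q}$ by the coordinates of all points of $E(\overline{\mathbb{Q}})$ of order dividing $N$. $\zeta_N$ denotes a primitive $N$-th root of unity. *)

theory Defs
  imports "HOL-Algebra.Algebraic_Closure_Type" "HOL-Algebra.Generated_Fields"
begin

text \<open>
  Elliptic curves in short Weierstrass form \<open>y\<^sup>2 = x\<^sup>3 + a x + b\<close>, over a field of
  characteristic different from 2 and 3. The point at infinity is the neutral element of the
  group law.
\<close>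

datatype 'a point = Infinity | Affine 'a 'a

definition nonsingular :: "'a::field \<Rightarrow> 'a \<Rightarrow> bool" where
  "nonsingular a b \<longleftrightarrow> 4 * a ^ 3 + 27 * b ^ 2 \<noteq> 0"

fun on_curve :: "'a::field \<Rightarrow> 'a \<Rightarrow> 'a point \<Rightarrow> bool" where
  "on_curve a b Infinity \<longleftrightarrow> True"
| "on_curve a b (Affine x y) \<longleftrightarrow> y ^ 2 = x ^ 3 + a * x + b"

text \<open>
  The chord-and-tangent law. It depends on the curve only through the coefficient \<open>a\<close>,
  which enters the slope of the tangent. For two points of the curve with the same
  \<open>x\<close>-coordinate, either \<open>y\<^sub>1 = - y\<^sub>2\<close> (they are opposite) or \<open>y\<^sub>1 = y\<^sub>2 \<noteq> 0\<close> (doubling).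
\<close>

fun point_add :: "'a::field \<Rightarrow> 'a point \<Rightarrow> 'a point \<Rightarrow> 'a point" where
  "point_add a Infinity Q = Q"
| "point_add a P Infinity = P"
| "point_add a (Affine x1 y1) (Affine x2 y2) =
     (if x1 = x2 \<and> y1 = - y2 then Infinity
      else let m = (if x1 = x2 then (3 * x1 ^ 2 + a) / (2 * y1) else (y2 - y1) / (x2 - x1));
               x3 = m ^ 2 - x1 - x2
           in Affine x3 (m * (x1 - x3) - y1))"

fun point_mult :: "'a::field \<Rightarrow> nat \<Rightarrow> 'a point \<Rightarrow> 'a point" where
  "point_mult a 0 P = Infinity"
| "point_mult a (Suc n) P = point_add a P (point_mult a n P)"

definition torsion_points :: "'a::field \<Rightarrow> 'a \<Rightarrow> nat \<Rightarrow> 'a point set" where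
  "torsion_points a b N = {P. on_curve a b P \<and> point_mult a N P = Infinity}"

text \<open>
  The algebraic closure of the rationals is the library type \<^typ>\<open>rat alg_closure\<close>, with
  embedding \<^const>\<open>to_ac\<close>; number fields are subsets of it.
\<close>

definition rat_adjoin :: "rat alg_closure set \<Rightarrow> rat alg_closure set" where
  "rat_adjoin S = generate_field ring_of_type_algebra (range to_ac \<union> S)"

definition division_field :: "rat \<Rightarrow> rat \<Rightarrow> nat \<Rightarrow> rat alg_closure set" where
  "division_field a b N =
     rat_adjoin (\<Union>P \<in> torsion_points (to_ac a) (to_ac b) N. set_point P)"

definition primitive_root_of_unity :: "nat \<Rightarrow> 'a::field \<Rightarrow> bool" where
  "primitive_root_of_unity N z \<longleftrightarrow> 0 < N \<and> z ^ N = 1 \<and> (\<forall>k. 0 < k \<and> k < N \<longrightarrow> z ^ k \<noteq> 1)"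

lemma nonsingular_32a3: "nonsingular (-11 :: rat) (-14)"
  by (simp add: nonsingular_def)

lemma on_curve_point_add:
  fixes a b :: "'a::field_char_0"
  assumes "on_curve a b P" "on_curve a b Q"
  shows "on_curve a b (point_add a P Q)"
proof (cases P)
  case Infinity
  then show ?thesis using assms by simp
next
  case P: (Affine x1 y1)
  show ?thesis
  proof (cases Q)
    case Infinity
    then show ?thesis using assms P by simp
  next
    case Q: (Affine x2 y2)
    have h1: "y1 ^ 2 = x1 ^ 3 + a * x1 + b" and h2: "y2 ^ 2 = x2 ^ 3 + a * x2 + b"
      using assms P Q by simp_all
    show ?thesis
    proof (cases "x1 = x2")
      case True
      have "(y1 - y2) * (y1 + y2) = 0"
        using h1 h2 True by (simp add: algebra_simps power2_eq_square)
      then have eq: "y1 = y2 \<or> y1 = - y2"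
        by (auto simp: add_eq_0_iff2)
      show ?thesis
      proof (cases "y1 = - y2")
        case False
        with eq have y: "y1 = y2" "y1 \<noteq> 0" by auto
        define m where "m = (3 * x1 ^ 2 + a) / (2 * y1)"
        have m: "2 * y1 * m = 3 * x1 ^ 2 + a" using y by (simp add: m_def)
        have "(m * (x1 - (m ^ 2 - x1 - x1)) - y1) ^ 2 =
          (m ^ 2 - x1 - x1) ^ 3 + a * (m ^ 2 - x1 - x1) + b"
        proof -
          have a: "a = 2 * y1 * m - 3 * x1 ^ 2" using m by simp
          have b: "b = y1 ^ 2 - x1 ^ 3 - (2 * y1 * m - 3 * x1 ^ 2) * x1" using h1 a by simp
          show ?thesis unfolding b a by (simp add: algebra_simps power2_eq_square power3_eq_cube)
        qed
        then show ?thesis using P Q True False y by (simp add: Let_def m_def)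
      qed (use P Q True in simp)
    next
      case False
      define m where "m = (y2 - y1) / (x2 - x1)"
      have m: "m * (x2 - x1) = y2 - y1" using False by (simp add: m_def)
      have y2: "y2 = y1 + m * (x2 - x1)" using m by simp
      have "(x2 - x1) * (m * (y1 + y2)) = (x2 - x1) * (x1 ^ 2 + x1 * x2 + x2 ^ 2 + a)"
      proof -
        have "(x2 - x1) * (m * (y1 + y2)) = (m * (x2 - x1)) * (y1 + y2)"
          by (simp only: ac_simps)
        also have "\<dots> = y2 ^ 2 - y1 ^ 2"
          unfolding m by (simp add: algebra_simps power2_eq_square)
        also have "\<dots> = (x2 - x1) * (x1 ^ 2 + x1 * x2 + x2 ^ 2 + a)"
          unfolding h1 h2 by (simp add: algebra_simps power2_eq_square power3_eq_cube)
        finally show ?thesis .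
      qed
      then have "m * (y1 + y2) = x1 ^ 2 + x1 * x2 + x2 ^ 2 + a"
        using False by simp
      then have a: "a = m * (2 * y1 + m * (x2 - x1)) - x1 ^ 2 - x1 * x2 - x2 ^ 2"
        unfolding y2 by (simp add: algebra_simps)
      have b: "b = y1 ^ 2 - x1 ^ 3 - (m * (2 * y1 + m * (x2 - x1)) - x1 ^ 2 - x1 * x2 - x2 ^ 2) * x1"
        using h1 a by simp
      have "(m * (x1 - (m ^ 2 - x1 - x2)) - y1) ^ 2 =
        (m ^ 2 - x1 - x2) ^ 3 + a * (m ^ 2 - x1 - x2) + b"
        unfolding b a by (simp add: algebra_simps power2_eq_square power3_eq_cube)
      then show ?thesis using P Q False by (simp add: Let_def m_def)
    qed
  qed
qed

end

theory Submission
  imports Defs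
begin

text \<open>
  The curve 32a3 is 2-isogenous to the lemniscatic curve \<open>y\<^sup>2 = x\<^sup>3 - x\<close>, which has complex
  multiplication by \<open>\<int>[i]\<close>, where \<open>[i](x, y) = (- x, i y)\<close>. For a point \<open>P\<close> of exact order \<open>N = 2\<^sup>n\<close>
  on the latter, the Weil pairing of \<open>P\<close> and \<open>[i]P\<close> has a square root that is rational over
  \<open>\<rat>(i, P)\<close>: the net \<open>W(a) = \<sigma>(a u) / \<sigma>(u)\<^bsup>|a|\<^sup>2\<^esup>\<close> on \<open>\<int>[i]\<close> satisfies \<open>W(a + N) = \<delta> \<chi>(a) W(a)\<close> with
  a character \<open>\<chi>\<close>, and since \<open>W(i a) = i W(a)\<close>, the value \<open>\<chi>(i)\<close> is a primitive \<open>2 N\<close>-th root of unity.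
  Miller's doubling algorithm writes \<open>\<chi>(i)\<close> up to sign as an explicit product over the points
  \<open>P, 2 P, 4 P, \<dots>\<close>. That this product has order \<open>2 N\<close> follows by induction on \<open>n\<close> from two rational
  identities, so that neither \<open>\<sigma>\<close> nor the Weil pairing is needed.
\<close>

section \<open>Doubling on a short Weierstrass curve\<close>

definition tangent_slope :: "'a::field \<Rightarrow> 'a \<Rightarrow> 'a \<Rightarrow> 'a" where
  "tangent_slope a x y = (3 * x ^ 2 + a) / (2 * y)"

definition dbl_x :: "'a::field \<Rightarrow> 'a \<Rightarrow> 'a \<Rightarrow> 'a" where
  "dbl_x a x y = tangent_slope a x y ^ 2 - x - x"

definition dbl_y :: "'a::field \<Rightarrow> 'a \<Rightarrow> 'a \<Rightarrow> 'a" where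
  "dbl_y a x y = tangent_slope a x y * (x - dbl_x a x y) - y"

lemma point_add_self:
  fixes y :: "'a::field_char_0"
  assumes "y \<noteq> 0"
  shows "point_add a (Affine x y) (Affine x y) = Affine (dbl_x a x y) (dbl_y a x y)"
proof -
  have "y \<noteq> - y" using assms by (simp add: eq_neg_iff_add_eq_0)
  then show ?thesis by (simp add: dbl_x_def dbl_y_def tangent_slope_def Let_def)
qed

lemma on_curve_double:
  fixes y :: "'a::field_char_0"
  assumes "y \<noteq> 0" "on_curve a b (Affine x y)"
  shows "on_curve a b (Affine (dbl_x a x y) (dbl_y a x y))"
  using on_curve_point_add[OF assms(2) assms(2)] point_add_self[OF assms(1)] by simp

lemma tangent_slope_mult:
  fixes y :: "'a::field_char_0"
  assumes "y \<noteq> 0"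
  shows "2 * y * tangent_slope a x y = 3 * x ^ 2 + a"
  using assms by (simp add: tangent_slope_def)

text \<open>
  The chord of slope \<open>l\<close> through \<open>(x, y)\<close> and \<open>(x + d, y + l * d)\<close> meets the curve a third time
  at abscissa \<open>x + e\<close> with \<open>e = l\<^sup>2 - 3 x - d\<close>.
\<close>

lemma chord_tangent:
  fixes x :: "'a::field_char_0"
  assumes d: "d \<noteq> 0" and m: "2 * y * m = 3 * x ^ 2 + a"
    and P: "y ^ 2 = x ^ 3 + a * x + b"
    and Q: "(y + l * d) ^ 2 = (x + d) ^ 3 + a * (x + d) + b"
  shows "2 * y * (l - m) = - d * (l ^ 2 - 3 * x - d)"
proof -
  have a: "a = 2 * y * m - 3 * x ^ 2" using m by (simp add: algebra_simps)
  have "(y + l * d) ^ 2 - y ^ 2 = (x + d) ^ 3 + a * (x + d) - (x ^ 3 + a * x)"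
    using P Q by simp
  then have "d * (2 * y * (l - m)) = d * (- d * (l ^ 2 - 3 * x - d))"
    unfolding a by (simp add: algebra_simps power2_eq_square power3_eq_cube)
  then show ?thesis using d mult_left_cancel by blast
qed

text \<open>The reflected tangent touches the curve at \<open>-P\<close> and meets it again at
  \<open>2P\<close>, so the chord construction returns \<open>P\<close>. If \<open>2P\<close> has
  the abscissa of \<open>P\<close>, then \<open>2P = -P\<close> and the sum is a doubling. This
  supplies the case \<open>R = -P\<close> of \<open>point_add_twice\<close>.\<close>

lemma point_add_double_opposite:
  fixes y :: "'a::field_char_0"
  assumes y: "y \<noteq> 0"
  shows "point_add a (Affine (dbl_x a x y) (dbl_y a x y)) (Affine x (- y)) = Affine x y"
proof -
  define m where "m = tangent_slope a x y"
  have ny: "y \<noteq> - y" using y by (simp add: eq_neg_iff_add_eq_0)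
  have X: "dbl_x a x y = m ^ 2 - x - x" by (simp add: dbl_x_def m_def)
  have Y: "dbl_y a x y = m * (x - dbl_x a x y) - y" by (simp add: dbl_y_def m_def)
  show ?thesis
  proof (cases "dbl_x a x y = x")
    case True
    then have Y': "dbl_y a x y = - y" using Y by simp
    have s: "(3 * x ^ 2 + a) / (2 * - y) = - m" by (simp add: m_def tangent_slope_def)
    show ?thesis using True Y' s X ny y by (simp add: Let_def)
  next
    case False
    have s: "(- y - dbl_y a x y) / (x - dbl_x a x y) = - m"
      using False Y by (simp add: field_simps)
    show ?thesis
      using False unfolding point_add.simps s Let_def by (simp add: X Y algebra_simps)
  qed
qed

text \<open>
  The slopes used on the two sides are tied by
  \<open>l + l' = m + n\<close>, where \<open>l\<close>, \<open>l'\<close>, \<open>m\<close>, \<open>n\<close> belong to \<open>P + R\<close>, \<open>P + (P + R)\<close>, \<open>P + P\<close> and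
  \<open>2 P + R\<close>.
\<close>

lemma point_add_twice:
  fixes x y :: "'a::field_char_0"
  assumes P: "on_curve a b (Affine x y)" and R: "on_curve a b R" and y: "y \<noteq> 0"
  shows "point_add a (Affine x y) (point_add a (Affine x y) R) =
         point_add a (Affine (dbl_x a x y) (dbl_y a x y)) R"
proof (cases R)
  case Infinity
  then show ?thesis using y by (simp add: point_add_self del: point_add.simps(3))
next
  case R': (Affine r s)
  define m where "m = tangent_slope a x y"
  define px where "px = dbl_x a x y"
  define py where "py = dbl_y a x y"
  have ny: "y \<noteq> - y" using y by (simp add: eq_neg_iff_add_eq_0)
  have m: "2 * y * m = 3 * x ^ 2 + a" using y by (simp add: m_def tangent_slope_mult)
  have px: "px = m ^ 2 - 2 * x" by (simp add: px_def dbl_x_def m_def)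
  have py: "py = m * (x - px) - y" by (simp add: py_def dbl_y_def m_def px_def)
  have cP: "y ^ 2 = x ^ 3 + a * x + b" and cR: "s ^ 2 = r ^ 3 + a * r + b"
    using P R R' by simp_all
  show ?thesis
  proof (cases "r = x")
    case True
    have "(s - y) * (s + y) = 0"
      using cP cR True by (simp add: algebra_simps power2_eq_square)
    then consider "s = y" | "s = - y" by (auto simp: eq_neg_iff_add_eq_0)
    then show ?thesis
    proof cases
      case 1
      have comm: "point_add a (Affine x y) (Affine px py) = point_add a (Affine px py) (Affine x y)"
      proof (cases "x = px")
        case True
        then have "py = - y" using py by simp
        then show ?thesis using True by simp
      next
        case False
        define k where "k = (y - py) / (x - px)"
        have q: "(py - y) / (px - x) = k" using False by (simp add: k_def field_simps)
        have "y = py + k * (x - px)" using False by (simp add: k_def)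
        then show ?thesis using False unfolding point_add.simps q k_def[symmetric] Let_def
          by (simp add: algebra_simps)
      qed
      show ?thesis
        using 1 True R' comm y by (simp add: point_add_self px_def py_def del: point_add.simps(3))
    next
      case 2
      have "point_add a (Affine x y) R = Infinity" using 2 True R' by simp
      then show ?thesis
        using point_add_double_opposite[OF y, of a x] 2 True R' by simp
    qed
  next
    case False
    define d where "d = r - x"
    define l where "l = (s - y) / (r - x)"
    define e where "e = l ^ 2 - 3 * x - d"
    have d: "d \<noteq> 0" using False by (simp add: d_def)
    have r: "r = x + d" by (simp add: d_def)
    have s: "s = y + l * d" using False by (simp add: l_def d_def)
    have ct: "2 * y * (l - m) = - d * e"
      using chord_tangent[OF d m cP] cR unfolding r s e_def by simp
    have S: "point_add a (Affine x y) R = Affine (x + e) (- (y + l * e))"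
      using False unfolding R' point_add.simps l_def[symmetric]
      by (simp add: Let_def e_def r algebra_simps)
    show ?thesis
    \<comment> \<open>For \<open>e = 0\<close> the sum \<open>P + R\<close> is \<open>-P\<close>:
      the chord is the tangent at \<open>P\<close>, so \<open>R = -2P\<close> and both sides are
      \<open>Infinity\<close>.\<close>
    proof (cases "e = 0")
      case True
      then have lm: "l = m" using ct y by simp
      have dm: "d = m ^ 2 - 3 * x" using True lm by (simp add: e_def)
      have "r = px" by (simp add: r px dm)
      moreover have "s = - py" unfolding s py px lm dm by (simp add: algebra_simps)
      ultimately show ?thesis
        using True S R' by (simp add: px_def[symmetric] py_def[symmetric])
    next
      case e: False
      have lm: "l - m \<noteq> 0" using ct d e by auto
      \<comment> \<open>The slope of \<open>2P + R\<close>, written with denominator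
        \<open>l - m\<close> rather than \<open>r - px\<close> so that it also covers
        \<open>R = 2P\<close>.\<close>
      define n where "n = d / (l - m) - m"
      have nlm: "(n + m) * (l - m) = d" using lm by (simp add: n_def)
      define l' where "l' = (- (y + l * e) - y) / e"
      have "l' * e = - (y + l * e) - y" using e by (simp add: l'_def)
      then have l'e: "l' * e = - 2 * y - l * e" by simp
      have "(l + l') * e * (l - m) = (m + n) * e * (l - m)"
      proof -
        have "(l + l') * e * (l - m) = (l * e + l' * e) * (l - m)" by (simp add: algebra_simps)
        also have "\<dots> = - (2 * y * (l - m))" unfolding l'e by (simp add: algebra_simps)
        also have "\<dots> = d * e" unfolding ct by simp
        also have "\<dots> = (m + n) * e * (l - m)"
          unfolding nlm[symmetric] by (simp add: algebra_simps)
        finally show ?thesis .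
      qed
      then have "l + l' = m + n" using e lm by simp
      then have l': "l' = m + n - l" by (simp add: algebra_simps)
      have U: "point_add a (Affine x y) (point_add a (Affine x y) R) =
          Affine (l' ^ 2 - 2 * x - e) (l' * (3 * x + e - l' ^ 2) - y)"
      proof -
        have slope: "(- (y + l * e) - y) / (x + e - x) = l'" by (simp add: l'_def)
        show ?thesis
          using e unfolding S point_add.simps slope Let_def by (simp add: algebra_simps)
      qed
      have y2: "2 * y = - (n + m) * e"
      proof -
        have "2 * y * (l - m) = - (n + m) * e * (l - m)"
          unfolding ct nlm[symmetric] by (simp add: algebra_simps)
        then show ?thesis using lm by simp
      qed
      have ds: "d = (n + m) * (l - m)" using nlm by simp
      have e': "3 * x = l ^ 2 - d - e" by (simp add: e_def)
      have chord: "s - py = n * (r - px)"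
      proof -
        have "s - py = 2 * y + l * d - m * (3 * x - m ^ 2)"
          by (simp add: s py px algebra_simps)
        also have "\<dots> = n * (3 * x + d - m ^ 2)"
          unfolding y2 e' ds by (simp add: algebra_simps power2_eq_square)
        also have "\<dots> = n * (r - px)" by (simp add: r px algebra_simps)
        finally show ?thesis .
      qed
      have V: "point_add a (Affine px py) R = Affine (n ^ 2 - px - r) (n * (px - (n ^ 2 - px - r)) - py)"
      proof (cases "r = px")
        case False
        then have "(s - py) / (r - px) = n" using chord by simp
        then show ?thesis using False unfolding R' point_add.simps by (simp add: Let_def)
      next
        case True
        then have sY: "s = py" using chord by simp
        have dm: "d = m ^ 2 - 3 * x" using True by (simp add: r px algebra_simps)
        have e2: "e = (l - m) * (l + m)"
          by (simp add: e_def dm algebra_simps power2_eq_square)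
        have "2 * y * (l - m) = - d * (l + m) * (l - m)"
          unfolding ct e2 by (simp add: algebra_simps)
        then have y3: "2 * y = - d * (l + m)" using lm mult_right_cancel by blast
        have s2: "2 * s = d * (l - m)" using y3 by (simp add: s algebra_simps)
        then have s0: "s \<noteq> 0" using d lm by auto
        have "2 * s * n = d * ((n + m) * (l - m) - m * (l - m))"
          unfolding s2 by (simp add: algebra_simps)
        also have "\<dots> = d * (d - m * (l - m))" unfolding nlm ..
        also have "\<dots> = 3 * r ^ 2 - 3 * x ^ 2 + 2 * y * m"
        proof -
          have "3 * r ^ 2 - 3 * x ^ 2 + 2 * y * m = d * (3 * d + 6 * x) + - d * (l + m) * m"
            unfolding y3 by (simp add: r algebra_simps power2_eq_square)
          also have "3 * d + 6 * x = d + 2 * m ^ 2" unfolding dm by simp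
          finally show ?thesis by (simp add: algebra_simps power2_eq_square)
        qed
        also have "\<dots> = 3 * r ^ 2 + a" unfolding m by simp
        finally have "(3 * px ^ 2 + a) / (2 * py) = n"
          using s0 sY True by (simp add: field_simps)
        moreover have "py \<noteq> - py" using s0 sY by (simp add: eq_neg_iff_add_eq_0)
        ultimately show ?thesis using True sY unfolding R' point_add.simps by (simp add: Let_def)
      qed
      \<comment> \<open>Solving for \<open>x\<close> and \<open>y\<close> leaves \<open>l\<close>,
        \<open>m\<close>, \<open>n\<close>, \<open>e\<close> as free parameters, in which both
        coordinate equations are polynomial identities.\<close>
      have x: "x = (l ^ 2 - d - e) / 3" using e' by (simp add: field_simps)
      have y': "y = - (n + m) * e / 2" using y2 by (simp add: field_simps)
      have "l' ^ 2 - 2 * x - e = n ^ 2 - px - r"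
        unfolding l' r px ds x by (simp add: field_simps power2_eq_square)
      moreover have "l' * (3 * x + e - l' ^ 2) - y = n * (px - (n ^ 2 - px - r)) - py"
        unfolding l' r py px ds x y' by (simp add: field_simps power2_eq_square)
      ultimately show ?thesis using U V unfolding px_def py_def by simp
    qed
  qed
qed

lemma on_curve_point_mult:
  fixes a b :: "'a::field_char_0"
  assumes "on_curve a b P"
  shows "on_curve a b (point_mult a n P)"
  by (induction n) (simp_all add: assms on_curve_point_add)

text \<open>Each step uses \<open>P + (P + R) = 2P + R\<close> with \<open>R = 2kP\<close>. The
  orders of points in a halving chain are read off from this.\<close>

lemma point_mult_double:
  fixes x y :: "'a::field_char_0"
  assumes "on_curve a b (Affine x y)" "y \<noteq> 0"
  shows "point_mult a (2 * k) (Affine x y) = point_mult a k (Affine (dbl_x a x y) (dbl_y a x y))"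
proof (induction k)
  case (Suc k)
  have "point_mult a (2 * Suc k) (Affine x y) =
      point_add a (Affine x y) (point_add a (Affine x y) (point_mult a (2 * k) (Affine x y)))"
    by simp
  also have "\<dots> = point_add a (Affine (dbl_x a x y) (dbl_y a x y)) (point_mult a (2 * k) (Affine x y))"
    using assms by (intro point_add_twice on_curve_point_mult)
  finally show ?case using Suc by simp
qed simp

lemma point_mult_order_two: "point_mult a (2 * k) (Affine x 0) = Infinity"
  by (induction k) auto

section \<open>The tangent form\<close>

text \<open>Up to sign, the tangent line at the first point evaluated at the opposite of the second:
  the line function of Miller's algorithm.\<close>

definition tangent_form :: "'a::field \<Rightarrow> 'a \<Rightarrow> 'a \<Rightarrow> 'a \<Rightarrow> 'a \<Rightarrow> 'a" where
  "tangent_form a x1 y1 x2 y2 = y2 + y1 + tangent_slope a x1 y1 * (x2 - x1)"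

text \<open>Restricting the curve equation to the tangent gives a cubic with double root
  \<open>x1\<close> and remaining root \<open>dbl_x a x1 y1\<close>; up to sign the product is this
  cubic at \<open>x2\<close>.\<close>

lemma tangent_form_mult:
  fixes x1 :: "'a::field_char_0"
  assumes "y1 \<noteq> 0" "on_curve a b (Affine x1 y1)" "on_curve a b (Affine x2 y2)"
  shows "tangent_form a x1 y1 x2 y2 * tangent_form a x1 y1 x2 (- y2) =
    (x2 - x1) ^ 2 * (dbl_x a x1 y1 - x2)"
proof -
  define m where "m = tangent_slope a x1 y1"
  have a: "a = 2 * y1 * m - 3 * x1 ^ 2"
    using tangent_slope_mult[OF assms(1), of a x1] by (simp add: m_def algebra_simps)
  have b: "b = y1 ^ 2 - x1 ^ 3 - a * x1" using assms by simp
  have y2: "y2 * y2 = x2 ^ 3 + a * x2 + b" using assms by (simp add: power2_eq_square)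
  have "tangent_form a x1 y1 x2 y2 * tangent_form a x1 y1 x2 (- y2) =
      (y1 + m * (x2 - x1)) ^ 2 - y2 * y2"
    by (simp add: tangent_form_def m_def algebra_simps power2_eq_square)
  also have "\<dots> = (x2 - x1) ^ 2 * (m ^ 2 - x1 - x1 - x2)"
    unfolding y2 b a by (simp add: algebra_simps power2_eq_square power3_eq_cube)
  finally show ?thesis by (simp add: dbl_x_def m_def)
qed

text \<open>
  Up to the factor \<open>x\<^sub>2 - x(2 P\<^sub>1)\<close>, \<open>tangent_form\<close> is
  \<open>c(P\<^sub>1, P\<^sub>2) = \<sigma>(2 P\<^sub>1) \<sigma>(P\<^sub>1 + P\<^sub>2)\<^sup>2 / (\<sigma>(P\<^sub>1)\<^sup>2 \<sigma>(P\<^sub>2) \<sigma>(2 P\<^sub>1 + P\<^sub>2))\<close>, whence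
  \<open>c(P\<^sub>1, 2 P\<^sub>2) c(P\<^sub>2, P\<^sub>1)\<^sup>2 = c(P\<^sub>1, P\<^sub>2)\<^sup>2 c(P\<^sub>2, 2 P\<^sub>1)\<close>.
\<close>

lemma tangent_form_double:
  fixes x1 :: "'a::field_char_0"
  assumes y: "y1 \<noteq> 0" "y2 \<noteq> 0" and x: "x1 \<noteq> x2"
    and c1: "on_curve a b (Affine x1 y1)" and c2: "on_curve a b (Affine x2 y2)"
  shows "tangent_form a x1 y1 (dbl_x a x2 y2) (dbl_y a x2 y2) * tangent_form a x2 y2 x1 y1 ^ 2
           * (x2 - dbl_x a x1 y1) ^ 2 =
         - (tangent_form a x1 y1 x2 y2 ^ 2
           * tangent_form a x2 y2 (dbl_x a x1 y1) (dbl_y a x1 y1) * (x1 - dbl_x a x2 y2) ^ 2)"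
proof -
  \<comment> \<open>Parametrise by the chord slope \<open>l\<close>, the tangent slopes
    \<open>m\<close>, \<open>M\<close> and \<open>t\<close>; \<open>chord_tangent\<close>, applied
    from both ends of the chord, then expresses \<open>3 * x1\<close> and \<open>d\<close> through
    these.\<close>
  define d where "d = x2 - x1"
  define l where "l = (y2 - y1) / d"
  define m where "m = tangent_slope a x1 y1"
  define M where "M = tangent_slope a x2 y2"
  define t where "t = y1 / d"
  have d: "d \<noteq> 0" using x by (simp add: d_def)
  have x2: "x2 = x1 + d" by (simp add: d_def)
  have y1: "y1 = d * t" using d by (simp add: t_def)
  have y2: "y2 = d * t + l * d" using d by (simp add: l_def t_def)
  have "2 * y1 * (l - m) = - d * (l ^ 2 - 3 * x1 - d)"
    by (rule chord_tangent[OF d]) (use c1 c2 x2 y1 y2 y in \<open>simp_all add: m_def tangent_slope_mult\<close>)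
  then have "d * (2 * t * (l - m)) = d * - (l ^ 2 - 3 * x1 - d)" unfolding y1 by (simp add: algebra_simps)
  then have e1: "2 * t * (l - m) = - (l ^ 2 - 3 * x1 - d)" using d by (metis mult_left_cancel)
  have "2 * y2 * M = 3 * x2 ^ 2 + a" unfolding M_def by (rule tangent_slope_mult[OF y(2)])
  then have "2 * y2 * (l - M) = - (- d) * (l ^ 2 - 3 * x2 - (- d))"
    by (rule chord_tangent[where b = b, rotated]) (use d c1 c2 x2 y1 y2 in simp_all)
  then have "d * (2 * (t + l) * (l - M)) = d * (l ^ 2 - 3 * x2 + d)" unfolding y2 by (simp add: algebra_simps)
  then have e2: "2 * (t + l) * (l - M) = l ^ 2 - 3 * x2 + d" using d by (metis mult_left_cancel)
  have x1': "3 * x1 = 2 * t * (l - m) + l ^ 2 - d" using e1 by (simp add: algebra_simps)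
  have d': "d = - 2 * t * (l - m) - 2 * (t + l) * (l - M)"
  proof -
    have "2 * (t + l) * (l - M) = l ^ 2 - 3 * x1 - 2 * d" unfolding e2 x2 by simp
    also have "\<dots> = - 2 * t * (l - m) - d" unfolding x1' by simp
    finally show ?thesis by simp
  qed
  \<comment> \<open>With \<open>u\<close> and \<open>v\<close> all four tangent forms and both
    abscissa differences factor, and the claim reduces to \<open>key\<close>.\<close>
  define u v where "u = 2 * t + l + m" and "v = 2 * t + l - M"
  have f: "dbl_x a x2 y2 - x1 = (l - M) * v"
  proof -
    have "dbl_x a x2 y2 - x1 = M ^ 2 - 3 * x1 - 2 * d" by (simp add: dbl_x_def M_def x2)
    also have "\<dots> = M ^ 2 - 2 * t * (l - m) - l ^ 2 - d" unfolding x1' by simp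
    also have "\<dots> = (l - M) * v"
      by (subst d') (simp add: v_def algebra_simps power2_eq_square)
    finally show ?thesis .
  qed
  have h: "x2 - dbl_x a x1 y1 = (l - m) * u"
  proof -
    have "x2 - dbl_x a x1 y1 = d + 3 * x1 - m ^ 2" by (simp add: dbl_x_def m_def x2)
    also have "\<dots> = (l - m) * u"
      unfolding x1' by (simp add: u_def algebra_simps power2_eq_square)
    finally show ?thesis .
  qed
  have n1: "tangent_form a x1 y1 x2 y2 = d * u"
    unfolding tangent_form_def m_def[symmetric] unfolding x2 y1 y2 by (simp add: u_def algebra_simps)
  have n2: "tangent_form a x2 y2 x1 y1 = d * v"
    unfolding tangent_form_def M_def[symmetric] unfolding x2 y1 y2 by (simp add: v_def algebra_simps)
  have n3: "tangent_form a x1 y1 (dbl_x a x2 y2) (dbl_y a x2 y2) = (l - M) * ((m - M) * v - d)"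
  proof -
    have "tangent_form a x1 y1 (dbl_x a x2 y2) (dbl_y a x2 y2) =
        (M - l) * d + (m - M) * (dbl_x a x2 y2 - x1)"
      unfolding tangent_form_def dbl_y_def m_def[symmetric] M_def[symmetric]
      by (simp add: y1 y2 x2 algebra_simps)
    also have "\<dots> = (l - M) * ((m - M) * v - d)" unfolding f by (simp add: algebra_simps)
    finally show ?thesis .
  qed
  have n4: "tangent_form a x2 y2 (dbl_x a x1 y1) (dbl_y a x1 y1) = (l - m) * (d + (m - M) * u)"
  proof -
    have "tangent_form a x2 y2 (dbl_x a x1 y1) (dbl_y a x1 y1) =
        (l - m) * d + (m - M) * (x2 - dbl_x a x1 y1)"
      unfolding tangent_form_def dbl_y_def m_def[symmetric] M_def[symmetric]
      by (simp add: y1 y2 x2 algebra_simps)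
    also have "\<dots> = (l - m) * (d + (m - M) * u)" unfolding h by (simp add: algebra_simps)
    finally show ?thesis .
  qed
  have key: "(l - m) * ((m - M) * v - d) = - ((l - M) * (d + (m - M) * u))"
    unfolding d' u_def v_def by (simp add: algebra_simps)
  have f': "(x1 - dbl_x a x2 y2) ^ 2 = ((l - M) * v) ^ 2"
    using f by (metis power2_commute)
  have "(l - M) * ((m - M) * v - d) * (d * v) ^ 2 * ((l - m) * u) ^ 2 =
      (l - M) * (l - m) * (d * v * u) ^ 2 * ((l - m) * ((m - M) * v - d))"
    by (simp add: power2_eq_square mult_ac)
  also have "\<dots> = - ((d * u) ^ 2 * ((l - m) * (d + (m - M) * u)) * ((l - M) * v) ^ 2)"
    unfolding key by (simp add: power2_eq_square mult_ac)
  finally show ?thesis unfolding n1 n2 n3 n4 h f' .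
qed


section \<open>Doubling chains on the lemniscatic curve\<close>

text \<open>Points with \<open>2 P_(k+1) = P_k\<close>, starting at the 2-torsion point
  \<open>(1, 0)\<close>. This start is not fixed by \<open>[i]\<close>, which sends it to
  \<open>(-1, 0)\<close>; that keeps the chain apart from its image under
  \<open>[i]\<close>.\<close>

locale lemniscatic_chain =
  fixes i :: "'a::field_char_0" and x y :: "nat \<Rightarrow> 'a"
  assumes i_squared: "i ^ 2 = - 1"
    and x_0: "x 0 = 1"
    and y_Suc: "y (Suc k) \<noteq> 0"
    and on_curve: "on_curve (- 1) 0 (Affine (x k) (y k))"
    and dbl_x_Suc: "dbl_x (- 1) (x (Suc k)) (y (Suc k)) = x k"
    and dbl_y_Suc: "dbl_y (- 1) (x (Suc k)) (y (Suc k)) = y k"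
begin

lemma y_squared: "y k ^ 2 = x k ^ 3 - x k"
  using on_curve[of k] by simp

lemma y_0: "y 0 = 0"
  using y_squared[of 0] x_0 by simp

lemma x_Suc: "4 * (x (Suc k) ^ 3 - x (Suc k)) * x k = (x (Suc k) ^ 2 + 1) ^ 2"
proof -
  define u w m where "u = x (Suc k)" and "w = y (Suc k)" and "m = tangent_slope (- 1) u w"
  have m: "2 * w * m = 3 * u ^ 2 - 1"
    using tangent_slope_mult[of w "- 1" u] y_Suc by (simp add: w_def m_def)
  have w2: "w ^ 2 = u ^ 3 - u" unfolding u_def w_def by (rule y_squared)
  have "4 * w ^ 2 * x k = 4 * w ^ 2 * (m ^ 2 - 2 * u)"
    using dbl_x_Suc[of k] by (simp add: dbl_x_def u_def w_def m_def)
  also have "\<dots> = (2 * w * m) ^ 2 - 8 * w ^ 2 * u" by (simp add: algebra_simps power2_eq_square)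
  also have "\<dots> = (u ^ 2 + 1) ^ 2"
    unfolding m w2 by (simp add: algebra_simps power2_eq_square power3_eq_cube)
  finally show ?thesis unfolding w2 by (simp add: u_def)
qed

text \<open>A zero sum would make one point \<open>[i]\<close> or \<open>[-i]\<close> of the other.
  By \<open>x_Suc\<close> duplication is odd in the abscissa, so the relation descends to smaller
  indices until one abscissa is \<open>x 0 = 1\<close>; the other would be \<open>-1\<close>, where
  the ordinate vanishes.\<close>

lemma x_sum_nonzero: "x j + x k \<noteq> 0"
proof -
  have ne: "x (Suc k) ^ 3 - x (Suc k) \<noteq> 0" for k
    using y_squared[of "Suc k"] y_Suc[of k] by auto
  have aux: "x j + x (j + k) \<noteq> 0" for j k
  proof (induction j)
    case 0
    show ?case
    proof (cases k)
      case (Suc l)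
      have "x (Suc l) \<noteq> - 1" using ne[of l] by auto
      then show ?thesis using Suc x_0 by (auto simp: add_eq_0_iff)
    qed (simp add: x_0)
  next
    case (Suc j)
    show ?case
    proof
      assume "x (Suc j) + x (Suc j + k) = 0"
      then have opp: "x (Suc (j + k)) = - x (Suc j)" by (simp add: add_eq_0_iff2 add_eq_0_iff)
      have "- (4 * (x (Suc j) ^ 3 - x (Suc j)) * x (j + k)) = 4 * (x (Suc j) ^ 3 - x (Suc j)) * x j"
      proof -
        have "- (4 * (x (Suc j) ^ 3 - x (Suc j)) * x (j + k)) =
            4 * ((- x (Suc j)) ^ 3 - - x (Suc j)) * x (j + k)"
          by (simp add: algebra_simps)
        then show ?thesis using x_Suc[of "j + k"] x_Suc[of j] unfolding opp by simp
      qed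
      then have "4 * (x (Suc j) ^ 3 - x (Suc j)) * (x j + x (j + k)) = 0"
        by (simp add: algebra_simps)
      then show False using Suc ne[of j] by simp
    qed
  qed
  show ?thesis
    using aux[of j "k - j"] aux[of k "j - k"] by (cases "j \<le> k") (simp_all add: add.commute)
qed

text \<open>For \<open>s = i\<close> and \<open>s = - i\<close> this is the tangent form at the \<open>j\<close>-th point and \<open>[s]\<close> of the \<open>k\<close>-th one.\<close>

definition F :: "'a \<Rightarrow> nat \<Rightarrow> nat \<Rightarrow> 'a" where
  "F s j k = tangent_form (- 1) (x j) (y j) (- x k) (s * y k)"

text \<open>The factor relating the tangent form to \<open>c\<close> depends only on the abscissa
  \<open>- x k\<close>, shared by \<open>[i]P_k\<close> and \<open>[-i]P_k\<close>. It cancels here,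
  leaving \<open>c(P_j, [-i]P_k) / c(P_j, [i]P_k)\<close>.\<close>

definition G :: "nat \<Rightarrow> nat \<Rightarrow> 'a" where
  "G j k = F (- i) j k / F i j k"

lemma on_curve_mult_i:
  assumes "s ^ 2 = - 1"
  shows "on_curve (- 1) 0 (Affine (- x k) (s * y k))"
  using assms y_squared[of k] by (simp add: power_mult_distrib)

lemma F_nonzero:
  assumes s: "s ^ 2 = - 1"
  shows "F s (Suc j) k \<noteq> 0"
proof -
  have "F s (Suc j) k * F (- s) (Suc j) k =
      (- x k - x (Suc j)) ^ 2 * (dbl_x (- 1) (x (Suc j)) (y (Suc j)) - - x k)"
    unfolding F_def mult_minus_left
    by (rule tangent_form_mult[OF y_Suc on_curve on_curve_mult_i[OF s]])
  also have "\<dots> = (x k + x (Suc j)) ^ 2 * (x j + x k)"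
    unfolding dbl_x_Suc by (simp add: algebra_simps power2_eq_square)
  also have "\<dots> \<noteq> 0" using x_sum_nonzero[of k "Suc j"] x_sum_nonzero[of j k] by simp
  finally show ?thesis by auto
qed

text \<open>The automorphism \<open>[s]\<close>, sending \<open>(x, y)\<close> to
  \<open>(- x, s y)\<close>, multiplies tangent slopes by \<open>- s\<close> and therefore commutes
  with doubling.\<close>

lemma
  assumes s: "s ^ 2 = - 1"
  shows dbl_x_mult_i: "dbl_x (- 1) (- x (Suc k)) (s * y (Suc k)) = - x k"
    and dbl_y_mult_i: "dbl_y (- 1) (- x (Suc k)) (s * y (Suc k)) = s * y k"
    and tangent_slope_mult_i:
      "tangent_slope (- 1) (- x j) (s * y j) = - s * tangent_slope (- 1) (x j) (y j)"
proof -
  have s0: "s \<noteq> 0" using s by auto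
  have inv: "1 / s = - s" using s s0 by (simp add: field_simps power2_eq_square)
  show ts: "tangent_slope (- 1) (- x j) (s * y j) = - s * tangent_slope (- 1) (x j) (y j)" for j
  proof -
    have "tangent_slope (- 1) (- x j) (s * y j) = 1 / s * tangent_slope (- 1) (x j) (y j)"
      by (simp add: tangent_slope_def)
    then show ?thesis unfolding inv .
  qed
  show dx: "dbl_x (- 1) (- x (Suc k)) (s * y (Suc k)) = - x k"
    using dbl_x_Suc[of k] unfolding dbl_x_def ts by (simp add: power_mult_distrib s algebra_simps)
  show "dbl_y (- 1) (- x (Suc k)) (s * y (Suc k)) = s * y k"
    using dbl_y_Suc[of k] unfolding dbl_y_def dx ts dbl_x_Suc by (simp add: algebra_simps)
qed

text \<open>Applying \<open>[-s]\<close>, the inverse of \<open>[s]\<close>, to both points moves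
  the automorphism from the base point to the argument, at the cost of the factor
  \<open>s\<close>.\<close>

lemma tangent_form_mult_i:
  assumes s: "s ^ 2 = - 1"
  shows "tangent_form (- 1) (- x k) (s * y k) (x j) (y j) = s * F (- s) k j"
proof -
  have "s * (s * y j) = - y j" using s by (simp add: power2_eq_square mult.assoc[symmetric])
  then show ?thesis
    by (simp add: tangent_form_def F_def tangent_slope_mult_i[OF s] algebra_simps)
qed

lemma F_double:
  assumes s: "s ^ 2 = - 1"
  shows "F s (Suc j) k * F (- s) (Suc k) (Suc j) ^ 2 * (x (Suc k) + x j) ^ 2 =
    s * (F s (Suc j) (Suc k) ^ 2 * F (- s) (Suc k) j * (x (Suc j) + x k) ^ 2)"
proof -
  have s0: "s \<noteq> 0" using s by auto
  have ne: "x (Suc j) \<noteq> - x (Suc k)" using x_sum_nonzero[of "Suc j" "Suc k"] by auto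
  have sy: "s * y (Suc k) \<noteq> 0" using s0 y_Suc by simp
  have "F s (Suc j) k * (s * F (- s) (Suc k) (Suc j)) ^ 2 * (- x (Suc k) - x j) ^ 2 =
    - (F s (Suc j) (Suc k) ^ 2 * (s * F (- s) (Suc k) j) * (x (Suc j) - - x k) ^ 2)"
    using tangent_form_double[OF y_Suc sy ne on_curve on_curve_mult_i[OF s]]
    unfolding dbl_x_Suc dbl_y_Suc dbl_x_mult_i[OF s] dbl_y_mult_i[OF s]
      tangent_form_mult_i[OF s] F_def[symmetric] .
  moreover have "(- x (Suc k) - x j) ^ 2 = (x (Suc k) + x j) ^ 2"
    by (simp add: power2_eq_square algebra_simps)
  ultimately show ?thesis by (simp add: power_mult_distrib s algebra_simps)
qed

lemma i_squared': "(- i) ^ 2 = - 1"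
  using i_squared by simp

text \<open>Divide \<open>F_double\<close> for \<open>- i\<close> by \<open>F_double\<close> for
  \<open>i\<close>: the squared abscissa sums cancel, and the scalars contribute
  \<open>- i / i = - 1\<close>.\<close>

lemma G_double: "G (Suc j) k * G (Suc k) j = - ((G (Suc j) (Suc k) * G (Suc k) (Suc j)) ^ 2)"
proof -
  define u v where "u = (x (Suc k) + x j) ^ 2" and "v = (x (Suc j) + x k) ^ 2"
  have uv: "u \<noteq> 0" "v \<noteq> 0" using x_sum_nonzero by (simp_all add: u_def v_def)
  note nz = F_nonzero[OF i_squared] F_nonzero[OF i_squared']
  have i0: "i \<noteq> 0" using i_squared by auto
  have p: "F i (Suc j) k * F (- i) (Suc k) (Suc j) ^ 2 * u =
      i * (F i (Suc j) (Suc k) ^ 2 * F (- i) (Suc k) j * v)"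
    using F_double[OF i_squared, of j k] by (simp add: u_def v_def)
  have n: "F (- i) (Suc j) k * F i (Suc k) (Suc j) ^ 2 * u =
      - i * (F (- i) (Suc j) (Suc k) ^ 2 * F i (Suc k) j * v)"
    using F_double[OF i_squared', of j k] by (simp add: u_def v_def)
  have "F (- i) (Suc j) k * F i (Suc k) (Suc j) ^ 2 * u *
        (i * (F i (Suc j) (Suc k) ^ 2 * F (- i) (Suc k) j * v)) =
      - i * (F (- i) (Suc j) (Suc k) ^ 2 * F i (Suc k) j * v) *
        (F i (Suc j) k * F (- i) (Suc k) (Suc j) ^ 2 * u)"
    unfolding n p ..
  then have "(u * v * i) * (F (- i) (Suc j) k * F i (Suc k) (Suc j) ^ 2 *
        F i (Suc j) (Suc k) ^ 2 * F (- i) (Suc k) j) =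
      (u * v * i) * (- (F (- i) (Suc j) (Suc k) ^ 2 * F i (Suc k) j *
        F i (Suc j) k * F (- i) (Suc k) (Suc j) ^ 2))"
    by (simp add: mult_ac)
  then have "F (- i) (Suc j) k * F i (Suc k) (Suc j) ^ 2 *
        F i (Suc j) (Suc k) ^ 2 * F (- i) (Suc k) j =
      - (F (- i) (Suc j) (Suc k) ^ 2 * F i (Suc k) j *
        F i (Suc j) k * F (- i) (Suc k) (Suc j) ^ 2)"
    using uv i0 by (metis mult_left_cancel mult_eq_0_iff)
  then show ?thesis
    unfolding G_def power_mult_distrib power_divide times_divide_times_eq minus_divide_left
    by (subst frac_eq_eq) (use nz in \<open>simp_all add: mult_ac\<close>)
qed

text \<open>The case \<open>j = k\<close> of \<open>G_double\<close> gives this up to the sign of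
  \<open>i\<close>; a direct computation with one point and its tangent slope fixes the
  sign.\<close>

lemma G_Suc_self: "G (Suc k) k = - i * G (Suc k) (Suc k) ^ 2"
proof -
  define u w m where "u = x (Suc k)" and "w = y (Suc k)" and "m = tangent_slope (- 1) u w"
  have ii: "i * i = - 1" using i_squared by (simp add: power2_eq_square)
  then have ii': "i * (i * z) = - z" for z by (simp add: mult.assoc[symmetric])
  have xk: "x k = m ^ 2 - 2 * u"
    using dbl_x_Suc[of k] by (simp add: dbl_x_def u_def w_def m_def)
  have yk: "y k = m * (u - x k) - w"
    using dbl_y_Suc[of k] unfolding dbl_y_def dbl_x_Suc by (simp add: u_def w_def m_def)
  have m: "2 * w * m = 3 * u ^ 2 - 1"
    using tangent_slope_mult[of w "- 1" u] y_Suc by (simp add: w_def m_def)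
  have w2: "w ^ 2 = u ^ 3 - u" unfolding u_def w_def by (rule y_squared)
  have "2 * u ^ 3 + w ^ 2 - 2 * m * u * w = 2 * u ^ 3 + (u ^ 3 - u) - u * (2 * w * m)"
    unfolding w2 by simp
  then have tangent: "2 * u ^ 3 + w ^ 2 - 2 * m * u * w = 0"
    unfolding m by (simp add: algebra_simps power2_eq_square power3_eq_cube)
  \<comment> \<open>Separate the terms free of \<open>s\<close> from those linear in
    \<open>s\<close>: \<open>F\<close> becomes \<open>p + s * q\<close>, the square of the diagonal
    \<open>F\<close> becomes \<open>r + s * t\<close>. The claim is then the relation
    \<open>key\<close>, a multiple of \<open>tangent\<close>.\<close>
  define p q r t where "p = w - m ^ 3 + m * u" and "q = 3 * m * u - m ^ 3 - w"
    and "r = 4 * m * u * (m * u - w)" and "t = 2 * w * (w - 2 * m * u)"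
  have F1: "F s (Suc k) k = p + s * q" for s
    unfolding F_def tangent_form_def u_def[symmetric] w_def[symmetric] m_def[symmetric] yk xk
    by (simp add: p_def q_def algebra_simps power2_eq_square power3_eq_cube)
  have F2: "F s (Suc k) (Suc k) ^ 2 = r + s * t" if "s * s = - 1" for s
  proof -
    have "F s (Suc k) (Suc k) ^ 2 = (w - 2 * m * u) ^ 2 + (s * s) * w ^ 2 + s * t"
      unfolding F_def tangent_form_def u_def[symmetric] w_def[symmetric] m_def[symmetric]
      by (simp add: t_def algebra_simps power2_eq_square)
    then show ?thesis unfolding that by (simp add: r_def algebra_simps power2_eq_square)
  qed
  have "(p - q) * r + (p + q) * t = - 4 * m ^ 3 * (2 * u ^ 3 + w ^ 2 - 2 * m * u * w)"
    by (simp add: p_def q_def r_def t_def algebra_simps power2_eq_square power3_eq_cube)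
  then have key: "p * r + q * t = q * r - p * t" unfolding tangent by (simp add: algebra_simps)
  have "(p + - i * q) * (r + i * t) = (p * r + q * t) + i * (p * t - q * r)"
    by (simp add: ii' algebra_simps)
  also have "\<dots> = - i * ((p * r + q * t) + i * (q * r - p * t))"
  proof -
    have "p * t - q * r = - (p * r + q * t)" using key by simp
    then show ?thesis unfolding key[symmetric] by (simp only:) (simp add: ii' algebra_simps)
  qed
  also have "\<dots> = - i * ((p + i * q) * (r + - i * t))"
    by (simp add: ii' algebra_simps)
  finally have "F (- i) (Suc k) k * F i (Suc k) (Suc k) ^ 2 =
      - i * (F i (Suc k) k * F (- i) (Suc k) (Suc k) ^ 2)"
    using ii by (simp add: F1 F2)
  then show ?thesis
    unfolding G_def power_divide times_divide_eq_right
    by (subst frac_eq_eq) (use F_nonzero[OF i_squared] in \<open>simp_all add: mult_ac\<close>)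
qed

lemma G_0: "G (Suc k) 0 = 1"
  using F_nonzero[OF i_squared, of k 0] by (simp add: G_def F_def y_0)

text \<open>A half of \<open>(1, 0)\<close> has \<open>u ^ 2 = 2 * u + 1\<close>. Then
  \<open>F s 1 1\<close> collapses to \<open>w * (s - u)\<close>, and the square of
  \<open>(- i - u) / (i - u)\<close> is \<open>i\<close>.\<close>

lemma G_1_1: "G 1 1 ^ 4 = - 1"
proof -
  define u w where "u = x 1" and "w = y 1"
  have w0: "w \<noteq> 0" using y_Suc[of 0] by (simp add: w_def)
  have "(u ^ 2 - 2 * u - 1) ^ 2 = 0"
    using x_Suc[of 0] x_0 by (simp add: u_def algebra_simps power2_eq_square power3_eq_cube)
  then have u: "u ^ 2 = 2 * u + 1" by (simp add: algebra_simps)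
  define m where "m = tangent_slope (- 1) u w"
  have mw: "m * (u - 1) = w"
    using dbl_y_Suc[of 0] dbl_x_Suc[of 0] unfolding dbl_y_def
    by (simp add: x_0 y_0 u_def w_def m_def)
  have uu: "u * (u - 1) = u + 1" using u by (simp add: algebra_simps power2_eq_square)
  have "(u - 1) * (w - 2 * u * m) = (u - 1) * w - 2 * u * (m * (u - 1))"
    by (simp add: algebra_simps)
  also have "\<dots> = - (u + 1) * w" unfolding mw by (simp add: algebra_simps)
  also have "\<dots> = (u - 1) * (- u * w)" unfolding uu[symmetric] by (simp add: algebra_simps)
  finally have "(u - 1) * (w - 2 * u * m) = (u - 1) * (- u * w)" .
  moreover have "u \<noteq> 1" using u by auto
  ultimately have base: "w - 2 * u * m = - u * w" by (metis mult_left_cancel right_minus_eq)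
  have F: "F s 1 1 = w * (s - u)" for s
  proof -
    have "F s 1 1 = s * w + (w - 2 * u * m)"
      unfolding F_def tangent_form_def u_def[symmetric] w_def[symmetric] m_def[symmetric]
      by (simp add: algebra_simps)
    then show ?thesis unfolding base by (simp add: algebra_simps)
  qed
  have nz: "i - u \<noteq> 0" using F_nonzero[OF i_squared, of 0 1] F[of i] by auto
  have "G 1 1 = (- i - u) / (i - u)" using w0 unfolding G_def F by simp
  moreover have "(- i - u) ^ 2 = i * (i - u) ^ 2"
  proof -
    have "(- i - u) ^ 2 = i ^ 2 + u ^ 2 + 2 * i * u" by (simp add: algebra_simps power2_eq_square)
    also have "\<dots> = 2 * u * (1 + i)" unfolding u i_squared by (simp add: algebra_simps)
    also have "\<dots> = i * (i ^ 2 + u ^ 2 - 2 * i * u)"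
    proof -
      have "i * (i * z) = - z" for z
        using i_squared by (simp add: power2_eq_square mult.assoc[symmetric])
      note this [simp]
      show ?thesis unfolding u i_squared by (simp add: algebra_simps)
    qed
    finally show ?thesis by (simp add: algebra_simps power2_eq_square)
  qed
  ultimately have "G 1 1 ^ 2 = i" using nz by (simp add: power_divide)
  then have "(G 1 1 ^ 2) ^ 2 = - 1" using i_squared by simp
  then show ?thesis by simp
qed

text \<open>The product given by Miller's algorithm; the \<open>k\<close>-th point of the chain has order \<open>2\<^bsup>k+1\<^esup>\<close>.\<close>

definition B :: "nat \<Rightarrow> 'a" where
  "B k = (\<Prod>l<k. G (Suc l) k ^ 2 ^ l)"

text \<open>The product telescopes: \<open>G_double\<close> trades \<open>G (Suc r) k\<close> and
  the boundary factor \<open>G (Suc k) r\<close> for the next pair. Its minus sign disappears under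
  the even exponent \<open>2 ^ Suc r\<close>, and \<open>G_0\<close> starts the induction.\<close>

lemma prod_G_double:
  "(\<Prod>l<r. G (Suc l) k ^ 2 ^ l) ^ 2 =
    (\<Prod>l<r. G (Suc l) (Suc k) ^ 2 ^ l) ^ 4 * G (Suc k) r ^ 2 ^ Suc r"
proof (induction r)
  case (Suc r)
  have "(\<Prod>l<Suc r. G (Suc l) k ^ 2 ^ l) ^ 2 =
      (\<Prod>l<r. G (Suc l) (Suc k) ^ 2 ^ l) ^ 4 * (G (Suc r) k * G (Suc k) r) ^ 2 ^ Suc r"
    using Suc by (simp add: power_mult_distrib power_mult[symmetric] mult_ac)
  also have "(G (Suc r) k * G (Suc k) r) ^ 2 ^ Suc r =
      (G (Suc r) (Suc k) ^ 2 ^ r) ^ 4 * G (Suc k) (Suc r) ^ 2 ^ Suc (Suc r)"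
    unfolding G_double by (simp add: power_mult_distrib power_mult[symmetric] mult_ac)
  finally show ?case by (simp add: power_mult_distrib mult_ac)
qed (simp add: G_0)

text \<open>At \<open>r = k\<close>, \<open>G_Suc_self\<close> turns the boundary factor into the
  missing last factor of \<open>B (Suc k) ^ 4\<close>; \<open>k > 0\<close> makes the power of
  \<open>- i\<close> equal to 1.\<close>

lemma B_Suc:
  assumes "k > 0"
  shows "B (Suc k) ^ 4 = B k ^ 2"
proof -
  obtain j where k: "k = Suc j" using assms by (cases k) auto
  have "(- i) ^ 2 ^ Suc k = ((- i) ^ 4) ^ 2 ^ j"
    by (simp add: k power_mult[symmetric] mult_ac)
  moreover have "(- i) ^ 4 = ((- i) ^ 2) ^ 2" by (simp only: power_mult[symmetric]) simp
  ultimately have i1: "(- i) ^ 2 ^ Suc k = 1" unfolding i_squared' by simp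
  have "B k ^ 2 = (\<Prod>l<k. G (Suc l) (Suc k) ^ 2 ^ l) ^ 4 * G (Suc k) k ^ 2 ^ Suc k"
    unfolding B_def by (rule prod_G_double)
  also have "G (Suc k) k ^ 2 ^ Suc k = (G (Suc k) (Suc k) ^ 2 ^ k) ^ 4"
    unfolding G_Suc_self power_mult_distrib i1 by (simp add: power_mult[symmetric] mult_ac)
  finally show ?thesis by (simp add: B_def power_mult_distrib)
qed

text \<open>Point \<open>Suc k\<close> has order \<open>2 ^ (k + 2)\<close>; the value
  \<open>- 1\<close> says that \<open>B (Suc k)\<close> has exactly twice that order.\<close>

lemma B_order:
  "B (Suc k) ^ 2 ^ Suc (Suc k) = - 1"
proof (induction k)
  case 0
  then show ?case using G_1_1 by (simp add: B_def)
next
  case (Suc k)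
  have "B (Suc (Suc k)) ^ 2 ^ Suc (Suc (Suc k)) = (B (Suc (Suc k)) ^ 4) ^ 2 ^ Suc k"
    by (simp add: power_mult[symmetric])
  also have "\<dots> = B (Suc k) ^ 2 ^ Suc (Suc k)"
    unfolding B_Suc[OF zero_less_Suc] by (simp add: power_mult[symmetric])
  finally show ?case using Suc by simp
qed

end

section \<open>The curve 32a3 and its quotient\<close>

text \<open>
  With \<open>u = x + 2\<close> the curve is \<open>y\<^sup>2 = u (u\<^sup>2 - 6 u + 1)\<close>, and dividing by the point \<open>u = 0\<close> of order
  two gives the lemniscatic curve.
\<close>

definition iso_x :: "'a::field \<Rightarrow> 'a" where
  "iso_x x = (x + 1) ^ 2 / (4 * (x + 2))"

definition iso_y :: "'a::field \<Rightarrow> 'a \<Rightarrow> 'a" where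
  "iso_y x y = y * ((x + 2) ^ 2 - 1) / (8 * (x + 2) ^ 2)"

lemma on_curve_32a3_iff:
  fixes x :: "'a::field_char_0"
  shows "on_curve (- 11) (- 14) (Affine x y) \<longleftrightarrow> y ^ 2 = (x + 2) * ((x + 2) ^ 2 - 6 * (x + 2) + 1)"
  by (simp add: algebra_simps power2_eq_square power3_eq_cube)

text \<open>In the coordinate \<open>u = x + 2\<close> the doubled abscissa is the square of
  \<open>(u ^ 2 - 1) / (2 * y)\<close>.\<close>

lemma dbl_x_32a3:
  fixes x :: "'a::field_char_0"
  assumes "on_curve (- 11) (- 14) (Affine x y)" "y \<noteq> 0"
  shows "4 * y ^ 2 * (dbl_x (- 11) x y + 2) = ((x + 2) ^ 2 - 1) ^ 2"
proof -
  define m where "m = tangent_slope (- 11) x y"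
  have m: "2 * y * m = 3 * x ^ 2 - 11"
    using tangent_slope_mult[OF assms(2), of "- 11" x] by (simp add: m_def)
  have y2: "y ^ 2 = x ^ 3 - 11 * x - 14" using assms by simp
  have "4 * y ^ 2 * (dbl_x (- 11) x y + 2) = (2 * y * m) ^ 2 - 4 * y ^ 2 * (2 * x - 2)"
    by (simp add: dbl_x_def m_def algebra_simps power2_eq_square)
  also have "\<dots> = ((x + 2) ^ 2 - 1) ^ 2"
    unfolding m y2 by (simp add: algebra_simps power2_eq_square power3_eq_cube)
  finally show ?thesis .
qed

lemma on_curve_iso:
  fixes x :: "'a::field_char_0"
  assumes c: "on_curve (- 11) (- 14) (Affine x y)" and x: "x + 2 \<noteq> 0"
  shows "on_curve (- 1) 0 (Affine (iso_x x) (iso_y x y))"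
proof -
  define u where "u = x + 2"
  have u: "u \<noteq> 0" using x by (simp add: u_def)
  have y2: "y ^ 2 = u * (u ^ 2 - 6 * u + 1)" using c unfolding on_curve_32a3_iff u_def .
  have X: "iso_x x = (u - 1) ^ 2 / (4 * u)" by (simp add: iso_x_def u_def add.commute)
  have "iso_y x y ^ 2 = y ^ 2 * (u ^ 2 - 1) ^ 2 / (8 * u ^ 2) ^ 2"
    by (simp add: iso_y_def u_def power_divide power_mult_distrib)
  also have "\<dots> = (u ^ 2 - 6 * u + 1) * (u ^ 2 - 1) ^ 2 / (64 * u ^ 3)"
    unfolding y2 using u by (simp add: power2_eq_square power3_eq_cube)
  also have "(u ^ 2 - 6 * u + 1) * (u ^ 2 - 1) ^ 2 = ((u - 1) ^ 2) ^ 3 - 16 * (u - 1) ^ 2 * u ^ 2"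
    by (simp add: algebra_simps power2_eq_square power3_eq_cube)
  also have "\<dots> / (64 * u ^ 3) = ((u - 1) ^ 2 / (4 * u)) ^ 3 - (u - 1) ^ 2 / (4 * u)"
    using u by (simp add: diff_divide_distrib power_divide power3_eq_cube power2_eq_square)
  finally show ?thesis unfolding X[symmetric] by simp
qed

lemma
  fixes x :: "'a::field_char_0"
  assumes c: "on_curve (- 11) (- 14) (Affine x y)" and y: "y \<noteq> 0"
    and D: "dbl_x (- 11) x y + 2 \<noteq> 0"
  shows iso_y_nonzero: "iso_y x y \<noteq> 0"
    and dbl_x_iso: "dbl_x (- 1) (iso_x x) (iso_y x y) = iso_x (dbl_x (- 11) x y)"
    and dbl_y_iso: "dbl_y (- 1) (iso_x x) (iso_y x y) = iso_y (dbl_x (- 11) x y) (dbl_y (- 11) x y)"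
proof -
  define u v m U W where "u = x + 2" and "v = (x + 2) ^ 2 - 1" and "m = tangent_slope (- 11) x y"
    and "U = dbl_x (- 11) x y + 2" and "W = dbl_y (- 11) x y"
  \<comment> \<open>By the duplication formula \<open>4 * c ^ 2 * U = 1\<close>, so \<open>U\<close>
    and the abscissa of the image of the doubled point are rational in \<open>q\<close>.\<close>
  define c where "c = y / v"
  define q where "q = c ^ 2"
  define M where "M = 3 * u ^ 2 - 12 * u + 1"
  define s where "s = (u - 1) ^ 2 / (4 * u)"
  define t where "t = c * v ^ 2 / (8 * u ^ 2)"
  \<comment> \<open>The tangent slope at the image point, as \<open>slope\<close> confirms.\<close>
  define n where "n = m / 2 + c / u"
  define s2 where "s2 = (1 - 4 * q) ^ 2 / (16 * q)"
  have v: "v = u ^ 2 - 1" by (simp add: u_def v_def)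
  have Uv: "4 * y ^ 2 * U = v ^ 2" using dbl_x_32a3[OF c y] by (simp add: U_def v_def)
  have y2: "y ^ 2 = u * (u ^ 2 - 6 * u + 1)" using c unfolding on_curve_32a3_iff u_def .
  have u0: "u \<noteq> 0" using y2 y by auto
  have v0: "v \<noteq> 0" using Uv y D by (auto simp: U_def)
  have c0: "c \<noteq> 0" using y v0 by (simp add: c_def)
  have q0: "q \<noteq> 0" using c0 by (simp add: q_def)
  have yc: "y = c * v" using v0 by (simp add: c_def)
  have qv: "q * v ^ 2 = u * (u ^ 2 - 6 * u + 1)"
    using y2 by (simp add: q_def yc power_mult_distrib)
  have "v ^ 2 * (4 * q * U) = v ^ 2 * 1" using Uv by (simp add: q_def yc power_mult_distrib mult_ac)
  then have qU: "4 * q * U = 1" using v0 by simp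
  then have U: "U = 1 / (4 * q)" using q0 by (simp add: field_simps)
  have M: "2 * c * v * m = M"
  proof -
    have "2 * y * m = 3 * x ^ 2 - 11" using tangent_slope_mult[OF y, of "- 11" x] by (simp add: m_def)
    moreover have "x = u - 2" by (simp add: u_def)
    ultimately show ?thesis by (simp add: yc M_def algebra_simps power2_eq_square)
  qed
  have X: "iso_x x = s" by (simp add: iso_x_def s_def u_def add.commute)
  have Y: "iso_y x y = t"
    unfolding iso_y_def u_def[symmetric] v_def[symmetric] t_def v[symmetric]
    by (simp add: yc power2_eq_square)
  have t0: "t \<noteq> 0" using c0 v0 u0 by (simp add: t_def)
  show "iso_y x y \<noteq> 0" using t0 Y by simp
  have slope: "tangent_slope (- 1) s t = n"
  proof -
    have "2 * t * n = v * (2 * c * v * m) / (16 * u ^ 2) + q * v ^ 2 / (4 * u ^ 3)"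
      using u0 by (simp add: t_def n_def q_def field_simps power2_eq_square power3_eq_cube)
    also have "\<dots> = 3 * s ^ 2 - 1"
      unfolding M qv using u0
      by (simp add: s_def M_def v field_simps power2_eq_square power3_eq_cube)
    finally show ?thesis using t0 by (simp add: tangent_slope_def field_simps)
  qed
  have X2: "iso_x (dbl_x (- 11) x y) = s2"
  proof -
    have "iso_x (dbl_x (- 11) x y) = (U - 1) ^ 2 / (4 * U)" by (simp add: iso_x_def U_def add.commute)
    moreover have "1 / (4 * q) - 1 = (1 - 4 * q) / (4 * q)" using q0 by (simp add: diff_divide_distrib)
    ultimately show ?thesis unfolding U s2_def using q0 by (simp add: power_divide power2_eq_square)
  qed
  have Y2: "iso_y (dbl_x (- 11) x y) (dbl_y (- 11) x y) = W * (1 - 16 * q ^ 2) / 8"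
  proof -
    have "iso_y (dbl_x (- 11) x y) (dbl_y (- 11) x y) = W * (U ^ 2 - 1) / (8 * U ^ 2)"
      by (simp add: iso_y_def U_def W_def)
    moreover have "U ^ 2 = 1 / (16 * q ^ 2)" by (simp add: U power_divide power_mult_distrib)
    moreover have "1 / (16 * q ^ 2) - 1 = (1 - 16 * q ^ 2) / (16 * q ^ 2)"
      using q0 by (simp add: diff_divide_distrib)
    ultimately have "iso_y (dbl_x (- 11) x y) (dbl_y (- 11) x y) =
        W * ((1 - 16 * q ^ 2) / (16 * q ^ 2)) / (8 * (1 / (16 * q ^ 2)))"
      by (simp only:)
    also have "\<dots> = W * (1 - 16 * q ^ 2) / 8"
      using q0 by (simp only: times_divide_eq_right divide_divide_eq_left mult_1_right) simp
    finally show ?thesis .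
  qed
  have ns: "n ^ 2 - 2 * s = s2"
  proof -
    have m2: "m ^ 2 = U + 2 * u - 6" by (simp add: U_def u_def m_def dbl_x_def)
    have mc: "m * c = M / (2 * v)" unfolding M[symmetric] using v0 by simp
    have q: "q = u * (u ^ 2 - 6 * u + 1) / v ^ 2" unfolding qv[symmetric] using v0 by simp
    have "n ^ 2 = m ^ 2 / 4 + m * c / u + q / u ^ 2"
      using u0 by (simp add: n_def q_def field_simps power2_eq_square)
    also have "\<dots> = 1 / (16 * q) + ((2 * u - 6) / 4 + M / (2 * v) / u + q / u ^ 2)"
      unfolding m2 mc U by (simp add: field_simps)
    also have "(2 * u - 6) / 4 + M / (2 * v) / u + q / u ^ 2 = q - 1 / 2 + 2 * s"
    proof -
      have "q - q / u ^ 2 = q * v ^ 2 / (u ^ 2 * v)"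
        using u0 v0 by (simp add: field_simps power2_eq_square) (simp add: v algebra_simps power2_eq_square)
      also have "\<dots> = (2 * u - 6) / 4 + M / (2 * v) / u + 1 / 2 - 2 * s"
        unfolding qv s_def M_def using u0 v0
        by (simp add: field_simps power2_eq_square) (simp add: v algebra_simps power2_eq_square)
      finally show ?thesis by (simp add: algebra_simps)
    qed
    finally show ?thesis using q0 by (simp add: s2_def field_simps power2_eq_square)
  qed
  show dx: "dbl_x (- 1) (iso_x x) (iso_y x y) = iso_x (dbl_x (- 11) x y)"
    using ns unfolding X2 unfolding X Y dbl_x_def slope by simp
  have "n * (s - s2) - t = W * (1 - 16 * q ^ 2) / 8"
  proof -
    define S where "S = 4 * q * (u - 1) ^ 2 - u * (1 - 4 * q) ^ 2"
    have a1: "4 * u * (c * v * n) = u * M + 4 * q * v"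
      unfolding M[symmetric] using u0 by (simp add: n_def q_def field_simps power2_eq_square)
    have a2: "16 * q * u * (s - s2) = S"
      using u0 q0 by (simp add: S_def s_def s2_def field_simps)
    have a3: "8 * u ^ 2 * (c * v * t) = q * v ^ 3"
      using u0 by (simp add: t_def q_def power2_eq_square power3_eq_cube)
    have W: "W = m * (u - U) - c * v"
      by (simp add: W_def dbl_y_def m_def u_def U_def yc[symmetric])
    have "8 * q * (c * v * W) = 2 * c * v * m * (4 * q * u - 4 * q * U) - 8 * q * (q * v ^ 2)"
      unfolding W by (simp add: q_def algebra_simps power2_eq_square)
    then have a4: "8 * q * (c * v * W) = M * (4 * q * u - 1) - 8 * q ^ 2 * v ^ 2"
      unfolding M qU by (simp add: power2_eq_square)
    \<comment> \<open>Once the nonzero denominators are cleared, the difference of the two sides is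
      a multiple of the curve equation \<open>qv\<close>.\<close>
    have "64 * q * u ^ 2 * (c * v) * (n * (s - s2) - t - W * (1 - 16 * q ^ 2) / 8) =
        (4 * u * (c * v * n)) * (16 * q * u * (s - s2)) - 8 * q * (8 * u ^ 2 * (c * v * t))
        - u ^ 2 * (8 * q * (c * v * W)) * (1 - 16 * q ^ 2)"
      by (simp add: field_simps power2_eq_square)
    also have "\<dots> = - 8 * q * (1 - 4 * u * q) ^ 2 * (q * v ^ 2 - u * (u ^ 2 - 6 * u + 1))"
      unfolding a1 a2 a3 a4 unfolding M_def S_def v
      by (simp add: algebra_simps power2_eq_square power3_eq_cube)
    also have "\<dots> = 0" unfolding qv by simp
    finally show ?thesis using q0 u0 c0 v0 by simp
  qed
  then show "dbl_y (- 1) (iso_x x) (iso_y x y) = iso_y (dbl_x (- 11) x y) (dbl_y (- 11) x y)"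
    unfolding dbl_y_def dx unfolding Y2[unfolded dbl_y_def] unfolding X2 unfolding X Y slope .
qed

text \<open>The quartic is the duplication formula with denominators cleared. Its roots are not
  2-torsion abscissas, and replacing \<open>y\<close> by \<open>- y\<close> corrects the sign of the
  doubled ordinate.\<close>

lemma ex_half_32a3:
  fixes x0 y0 :: "'a::{field_char_0, alg_closed_field}"
  assumes c0: "on_curve (- 11) (- 14) (Affine x0 y0)"
  shows "\<exists>x y. y \<noteq> 0 \<and> on_curve (- 11) (- 14) (Affine x y) \<and>
    dbl_x (- 11) x y = x0 \<and> dbl_y (- 11) x y = y0"
proof -
  define w where "w = x0 + 2"
  have "\<exists>u. poly [:1, - 4 * w, 24 * w - 2, - 4 * w, 1:] u = 0"
    by (rule alg_closed_imp_poly_has_root) simp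
  then obtain u where "poly [:1, - 4 * w, 24 * w - 2, - 4 * w, 1:] u = 0" ..
  then have u: "(u ^ 2 - 1) ^ 2 = 4 * (u * (u ^ 2 - 6 * u + 1)) * w"
    by (simp add: algebra_simps power2_eq_square)
  obtain y where y: "y ^ 2 = u * (u ^ 2 - 6 * u + 1)"
    using nth_root_exists[of 2 "u * (u ^ 2 - 6 * u + 1)"] by auto
  define x where "x = u - 2"
  have c: "on_curve (- 11) (- 14) (Affine x z)" if "z ^ 2 = y ^ 2" for z
    using y that unfolding on_curve_32a3_iff by (simp add: x_def)
  have y0: "y \<noteq> 0"
  proof
    assume "y = 0"
    then have z: "u * (u ^ 2 - 6 * u + 1) = 0" using y by simp
    then have "(u ^ 2 - 1) ^ 2 = 0" using u by simp
    then have "u ^ 2 = 1" by simp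
    then have "u = 1 \<or> u = - 1" by (simp add: power2_eq_1_iff)
    then show False using z by auto
  qed
  have X: "dbl_x (- 11) x z = x0" if "z ^ 2 = y ^ 2" for z
  proof -
    have "z \<noteq> 0" using that y0 by auto
    then have "4 * y ^ 2 * (dbl_x (- 11) x z + 2) = 4 * y ^ 2 * (x0 + 2)"
      using dbl_x_32a3[OF c[OF that]] that u y by (simp add: x_def w_def)
    then show ?thesis using y0 by simp
  qed
  have "on_curve (- 11) (- 14) (Affine (dbl_x (- 11) x y) (dbl_y (- 11) x y))"
    by (rule on_curve_double[OF y0 c]) simp
  then have "dbl_y (- 11) x y ^ 2 = y0 ^ 2" using c0 by (simp add: X)
  then consider "dbl_y (- 11) x y = y0" | "dbl_y (- 11) x y = - y0"
    by (auto simp: power2_eq_iff)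
  then show ?thesis
  proof cases
    case 1
    then show ?thesis using y0 c[of y] X[of y] by blast
  next
    case 2
    have "dbl_y (- 11) x (- y) = - dbl_y (- 11) x y"
      unfolding dbl_y_def X[OF refl] X[of "- y", simplified] by (simp add: tangent_slope_def)
    then have "- y \<noteq> 0 \<and> on_curve (- 11) (- 14) (Affine x (- y)) \<and>
        dbl_x (- 11) x (- y) = x0 \<and> dbl_y (- 11) x (- y) = y0"
      using 2 y0 c[of "- y"] X[of "- y"] by simp
    then show ?thesis by blast
  qed
qed

text \<open>The start is a 2-torsion point outside the kernel of the isogeny: the equation for
  \<open>x 0\<close> says \<open>u ^ 2 - 6 * u + 1 = 0\<close> for \<open>u = x 0 + 2\<close>, so
  \<open>x 0 = 1 + r\<close> with \<open>r ^ 2 = 8\<close>.\<close>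

lemma ex_chain_32a3:
  "\<exists>x y :: nat \<Rightarrow> 'a::{field_char_0, alg_closed_field}.
    (x 0) ^ 2 - 2 * x 0 = 7 \<and> y 0 = 0 \<and>
    (\<forall>k. on_curve (- 11) (- 14) (Affine (x k) (y k)) \<and> y (Suc k) \<noteq> 0 \<and>
      dbl_x (- 11) (x (Suc k)) (y (Suc k)) = x k \<and> dbl_y (- 11) (x (Suc k)) (y (Suc k)) = y k)"
proof -
  obtain r :: 'a where r: "r ^ 2 = 8" using nth_root_exists[of 2 "8 :: 'a"] by auto
  define c where "c p \<longleftrightarrow> on_curve (- 11) (- 14) (Affine (fst p) (snd p))" for p :: "'a \<times> 'a"
  define h where "h p q \<longleftrightarrow> snd q \<noteq> 0 \<and>
    dbl_x (- 11) (fst q) (snd q) = fst p \<and> dbl_y (- 11) (fst q) (snd q) = snd p" for p q :: "'a \<times> 'a"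
  have r2: "(1 + r) ^ 2 - 2 * (1 + r) = 7" using r by (simp add: algebra_simps power2_eq_square)
  have "\<exists>f. \<forall>n. (c (f n) \<and> (n = 0 \<longrightarrow> f n = (1 + r, 0))) \<and> h (f n) (f (Suc n))"
  \<comment> \<open>The invariant carries the condition at index 0, which prescribes the first
    point.\<close>
  proof (rule dependent_nat_choice[where
        P = "\<lambda>n p. c p \<and> (n = 0 \<longrightarrow> p = (1 + r, 0))" and Q = "\<lambda>n. h"])
    have "(3 + r) ^ 2 - 6 * (3 + r) + 1 = 0" using r by (simp add: algebra_simps power2_eq_square)
    then have "c (1 + r, 0)" unfolding c_def fst_conv snd_conv on_curve_32a3_iff
      by (simp add: add.commute add.left_commute)
    then show "\<exists>p. c p \<and> (0 = (0::nat) \<longrightarrow> p = (1 + r, 0))" by blast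
  next
    fix p n
    assume "c p \<and> (n = (0::nat) \<longrightarrow> p = (1 + r, 0))"
    then obtain x y where "y \<noteq> 0" "on_curve (- 11) (- 14) (Affine x y)"
      "dbl_x (- 11) x y = fst p" "dbl_y (- 11) x y = snd p"
      using ex_half_32a3[of "fst p" "snd p"] unfolding c_def by blast
    then have "c (x, y) \<and> h p (x, y)" by (simp add: c_def h_def)
    then show "\<exists>q. (c q \<and> (Suc n = 0 \<longrightarrow> q = (1 + r, 0))) \<and> h p q" by blast
  qed
  then obtain f where f: "\<And>n. c (f n)" "f 0 = (1 + r, 0)" "\<And>n. h (f n) (f (Suc n))" by blast
  show ?thesis
    using f r2 unfolding c_def h_def
    by (intro exI[of _ "\<lambda>n. fst (f n)"] exI[of _ "\<lambda>n. snd (f n)"]) auto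
qed

section \<open>Roots of unity in the division fields\<close>

lemma
  shows rat_adjoin_one: "1 \<in> rat_adjoin S"
    and rat_adjoin_incl: "z \<in> S \<Longrightarrow> z \<in> rat_adjoin S"
    and rat_adjoin_to_ac: "to_ac r \<in> rat_adjoin S"
    and rat_adjoin_add: "z \<in> rat_adjoin S \<Longrightarrow> w \<in> rat_adjoin S \<Longrightarrow> z + w \<in> rat_adjoin S"
    and rat_adjoin_mult: "z \<in> rat_adjoin S \<Longrightarrow> w \<in> rat_adjoin S \<Longrightarrow> z * w \<in> rat_adjoin S"
proof -
  let ?R = "ring_of_type_algebra :: rat alg_closure ring"
  let ?H = "range to_ac \<union> S"
  show "1 \<in> rat_adjoin S"
    using generate_field.one[of ?R ?H] by (simp add: rat_adjoin_def ring_of_type_algebra_def)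
  show "z \<in> S \<Longrightarrow> z \<in> rat_adjoin S" "to_ac r \<in> rat_adjoin S"
    unfolding rat_adjoin_def by (auto intro: generate_field.incl)
  show "z \<in> rat_adjoin S \<Longrightarrow> w \<in> rat_adjoin S \<Longrightarrow> z + w \<in> rat_adjoin S"
    using generate_field.eng_add[of z ?R ?H w] by (simp add: rat_adjoin_def ring_of_type_algebra_def)
  show "z \<in> rat_adjoin S \<Longrightarrow> w \<in> rat_adjoin S \<Longrightarrow> z * w \<in> rat_adjoin S"
    using generate_field.eng_mult[of z ?R ?H w] by (simp add: rat_adjoin_def ring_of_type_algebra_def)
qed

lemma rat_adjoin_numeral: "numeral k \<in> rat_adjoin S"
  using rat_adjoin_to_ac[of "numeral k" S] by simp

lemma rat_adjoin_uminus: "z \<in> rat_adjoin S \<Longrightarrow> - z \<in> rat_adjoin S"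
  using rat_adjoin_mult[OF rat_adjoin_to_ac[of "- 1"], of z S] by simp

lemma rat_adjoin_diff: "z \<in> rat_adjoin S \<Longrightarrow> w \<in> rat_adjoin S \<Longrightarrow> z - w \<in> rat_adjoin S"
  using rat_adjoin_add[OF _ rat_adjoin_uminus, of z S w] by simp

text \<open>With \<open>inverse 0 = 0\<close> closure under division is unconditional, so membership
  of slopes and quotients follows from their shape.\<close>

lemma rat_adjoin_inverse:
  assumes "z \<in> rat_adjoin S"
  shows "inverse z \<in> rat_adjoin S"
proof (cases "z = 0")
  case True
  then show ?thesis using assms by simp
next
  case False
  interpret Ring.field "ring_of_type_algebra :: rat alg_closure ring"
    by (rule field_from_type_algebra)
  have "inv\<^bsub>ring_of_type_algebra\<^esub> z = inverse z"
    using False by (intro comm_inv_char) (auto simp: ring_of_type_algebra_def)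
  moreover have "inv\<^bsub>ring_of_type_algebra\<^esub> z \<in> rat_adjoin S"
    using assms False unfolding rat_adjoin_def
    by (intro generate_field.m_inv) (auto simp: ring_of_type_algebra_def)
  ultimately show ?thesis by simp
qed

lemma rat_adjoin_divide: "z \<in> rat_adjoin S \<Longrightarrow> w \<in> rat_adjoin S \<Longrightarrow> z / w \<in> rat_adjoin S"
  by (simp add: divide_inverse rat_adjoin_mult rat_adjoin_inverse)

lemma rat_adjoin_power: "z \<in> rat_adjoin S \<Longrightarrow> z ^ k \<in> rat_adjoin S"
  by (induction k) (simp_all add: rat_adjoin_one rat_adjoin_mult)

lemma rat_adjoin_prod: "(\<And>j. j \<in> A \<Longrightarrow> f j \<in> rat_adjoin S) \<Longrightarrow> prod f A \<in> rat_adjoin S"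
  by (induction A rule: infinite_finite_induct) (simp_all add: rat_adjoin_one rat_adjoin_mult)

lemmas rat_adjoin_closed = rat_adjoin_one rat_adjoin_numeral rat_adjoin_uminus rat_adjoin_add
  rat_adjoin_diff rat_adjoin_mult rat_adjoin_divide rat_adjoin_power

lemma rat_adjoin_least:
  assumes "S \<subseteq> rat_adjoin T"
  shows "rat_adjoin S \<subseteq> rat_adjoin T"
proof -
  interpret Ring.field "ring_of_type_algebra :: rat alg_closure ring"
    by (rule field_from_type_algebra)
  show ?thesis
    unfolding rat_adjoin_def[of S]
  proof (rule generate_field_min_subfield1)
    show "subfield (rat_adjoin T) ring_of_type_algebra"
      unfolding rat_adjoin_def
      by (rule generate_field_is_subfield) (simp add: ring_of_type_algebra_def)
  qed (use assms rat_adjoin_to_ac in \<open>auto simp: ring_of_type_algebra_def\<close>)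
qed

text \<open>Induct by squaring both elements. The square root is determined up to sign, and
  \<open>- 1\<close> is itself a power of \<open>w\<close>.\<close>

lemma root_of_unity_is_power:
  fixes z w :: "'a::field"
  assumes "w ^ 2 ^ m = - 1" "z ^ 2 ^ Suc m = 1"
  shows "\<exists>k. z = w ^ k"
  using assms
proof (induction m arbitrary: z w)
  case 0
  then have "z = 1 \<or> z = w" by (simp add: power2_eq_1_iff)
  then show ?case by (metis power_0 power_one_right)
next
  case (Suc m)
  have "\<exists>k. z ^ 2 = (w ^ 2) ^ k"
    by (rule Suc.IH) (use Suc.prems in \<open>simp_all add: power_mult[symmetric]\<close>)
  then obtain k where "z ^ 2 = (w ^ k) ^ 2" by (auto simp: power_mult[symmetric] mult.commute)
  then have "z = w ^ k \<or> z = - (w ^ k)" by (simp add: power2_eq_iff)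
  moreover have "- (w ^ k) = w ^ (k + 2 ^ Suc m)"
    unfolding power_add Suc.prems(1) by simp
  ultimately show ?case by metis
qed

lemma division_field_coordinates:
  assumes "on_curve (to_ac a) (to_ac b) (Affine x y)" "point_mult (to_ac a) N (Affine x y) = Infinity"
  shows "x \<in> division_field a b N" "y \<in> division_field a b N"
proof -
  have "Affine x y \<in> torsion_points (to_ac a) (to_ac b) N"
    using assms by (simp add: torsion_points_def)
  then have "{x, y} \<subseteq> (\<Union>P\<in>torsion_points (to_ac a) (to_ac b) N. set_point P)" by force
  then show "x \<in> division_field a b N" "y \<in> division_field a b N"
    unfolding division_field_def by (auto intro!: rat_adjoin_incl)
qed

text \<open>The point \<open>(- 1, 2 * i)\<close> doubles to the 2-torsion point
  \<open>(- 2, 0)\<close>, so it is 4-torsion.\<close>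

lemma sqrt_neg_one_in_division_field:
  assumes n: "n > 1" and i: "i ^ 2 = - 1"
  shows "i \<in> division_field (- 11) (- 14) (2 ^ n)"
proof -
  obtain k where k: "n = Suc (Suc k)" using that[of "n - 2"] n by simp
  have i0: "i \<noteq> 0" using i by auto
  have c: "on_curve (- 11) (- 14) (Affine (- 1) (2 * i))"
    using i by (simp add: power_mult_distrib)
  have "1 / i = - i" using i i0 by (simp add: field_simps power2_eq_square)
  moreover have "tangent_slope (- 11) (- 1) (2 * i) = - 2 * (1 / i)" by (simp add: tangent_slope_def)
  ultimately have slope: "tangent_slope (- 11) (- 1) (2 * i) = 2 * i" by simp
  have X: "dbl_x (- 11) (- 1) (2 * i) = - 2"
    unfolding dbl_x_def slope using i by (simp add: power_mult_distrib)
  have Y: "dbl_y (- 11) (- 1) (2 * i) = 0" unfolding dbl_y_def slope X by simp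
  have "point_mult (- 11) (2 * (2 * 2 ^ k)) (Affine (- 1) (2 * i)) = Infinity"
    by (subst point_mult_double[OF c]) (use i0 in \<open>simp_all only: X Y point_mult_order_two\<close>, simp)
  then have "2 * i \<in> division_field (- 11) (- 14) (2 ^ n)"
    using c division_field_coordinates(2)[of "- 11" "- 14" "- 1" "2 * i"] by (simp add: k)
  then have "2 * i / 2 \<in> division_field (- 11) (- 14) (2 ^ n)"
    unfolding division_field_def by (rule rat_adjoin_divide) (rule rat_adjoin_numeral)
  then show ?thesis by simp
qed

theorem theorem1p5:
  fixes n :: nat and \<zeta> :: "rat alg_closure"
  assumes "n > 1" and "primitive_root_of_unity (2 ^ (n + 1)) \<zeta>"
  shows "rat_adjoin {\<zeta>} \<subseteq> division_field (-11) (-14) (2 ^ n)"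
proof -
  define L where "L = division_field (- 11) (- 14) (2 ^ n)"
  note closed = rat_adjoin_closed[where
      S = "\<Union>P\<in>torsion_points (to_ac (- 11)) (to_ac (- 14)) (2 ^ n). set_point P",
      folded division_field_def, folded L_def]
  obtain i :: "rat alg_closure" where i: "i ^ 2 = - 1"
    using nth_root_exists[of 2 "- 1 :: rat alg_closure"] by auto
  have iL: "i \<in> L" unfolding L_def using assms(1) i by (rule sqrt_neg_one_in_division_field)
  obtain x y :: "nat \<Rightarrow> rat alg_closure" where x0: "x 0 ^ 2 - 2 * x 0 = 7" and y0: "y 0 = 0"
    and c: "\<And>k. on_curve (- 11) (- 14) (Affine (x k) (y k))"
    and y: "\<And>k. y (Suc k) \<noteq> 0"
    and dx: "\<And>k. dbl_x (- 11) (x (Suc k)) (y (Suc k)) = x k"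
    and dy: "\<And>k. dbl_y (- 11) (x (Suc k)) (y (Suc k)) = y k"
    using ex_chain_32a3 by metis
  \<comment> \<open>The chain avoids the kernel point \<open>(- 2, 0)\<close>, where
    \<open>iso_x\<close> has its pole.\<close>
  have x2: "x k + 2 \<noteq> 0" for k
  proof (cases k)
    case 0
    have "x 0 \<noteq> - 2" using x0 by auto
    then show ?thesis using 0 by (simp add: add_eq_0_iff2)
  next
    case (Suc j)
    then show ?thesis using c[of k] y[of j] unfolding on_curve_32a3_iff by auto
  qed
  interpret lemniscatic_chain i "\<lambda>k. iso_x (x k)" "\<lambda>k. iso_y (x k) (y k)"
  proof
    have "(x 0 + 1) ^ 2 = 4 * (x 0 + 2)" using x0 by (simp add: algebra_simps power2_eq_square)
    moreover have "4 * (x 0 + 2) \<noteq> 0" using x2[of 0] by (metis mult_eq_0_iff zero_neq_numeral)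
    ultimately show "iso_x (x 0) = 1" unfolding iso_x_def by (metis divide_self)
    fix k
    show "iso_y (x (Suc k)) (y (Suc k)) \<noteq> 0"
      by (rule iso_y_nonzero[OF c y]) (simp add: dx x2)
    show "on_curve (- 1) 0 (Affine (iso_x (x k)) (iso_y (x k) (y k)))"
      by (rule on_curve_iso[OF c x2])
    show "dbl_x (- 1) (iso_x (x (Suc k))) (iso_y (x (Suc k)) (y (Suc k))) = iso_x (x k)"
      using dbl_x_iso[OF c y, of k] by (simp add: dx x2)
    show "dbl_y (- 1) (iso_x (x (Suc k))) (iso_y (x (Suc k)) (y (Suc k))) = iso_y (x k) (y k)"
      using dbl_y_iso[OF c y, of k] by (simp add: dx dy x2)
  qed (rule i)
  \<comment> \<open>The free factor \<open>j\<close> allows passing from \<open>2 ^ Suc k\<close> to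
    any larger power \<open>2 ^ n\<close>.\<close>
  have tors: "point_mult (- 11) (2 ^ Suc k * j) (Affine (x k) (y k)) = Infinity" for k j
  proof (induction k)
    case 0
    then show ?case using point_mult_order_two[of "- 11" j "x 0"] y0 by simp
  next
    case (Suc k)
    have "point_mult (- 11) (2 * (2 ^ Suc k * j)) (Affine (x (Suc k)) (y (Suc k))) = Infinity"
      by (subst point_mult_double[OF c y]) (simp only: dx dy Suc)
    then show ?case by (simp add: mult.assoc)
  qed
  have tors': "point_mult (- 11) (2 ^ n) (Affine (x k) (y k)) = Infinity" if "k < n" for k
  proof -
    have "(2::nat) ^ n = 2 ^ Suc k * 2 ^ (n - Suc k)" using that unfolding power_add[symmetric] by simp
    then show ?thesis by (simp only: tors)
  qed
  have xy: "x k \<in> L" "y k \<in> L" if "k < n" for k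
    using division_field_coordinates[of "- 11" "- 14" "x k" "y k" "2 ^ n"] c[of k] tors'[OF that]
    by (simp_all add: L_def)
  have iso: "iso_x (x k) \<in> L" "iso_y (x k) (y k) \<in> L" if "k < n" for k
    unfolding iso_x_def iso_y_def by (intro closed xy that)+
  \<comment> \<open>The isogeny has rational coefficients, so the image points have coordinates in
    \<open>L\<close>, and \<open>G\<close> is rational in these and \<open>i\<close>.\<close>
  have G: "G j k \<in> L" if "j < n" "k < n" for j k
    unfolding G_def F_def tangent_form_def tangent_slope_def
    by (intro closed iL iso that)
  obtain k where k: "n = Suc (Suc k)" using that[of "n - 2"] assms(1) by simp
  \<comment> \<open>\<open>Suc k = n - 1\<close> is the last index covered by \<open>tors'\<close>,
    and every \<open>G\<close> in the product has indices at most \<open>n - 1\<close>. By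
    \<open>B_order\<close>, \<open>B (Suc k)\<close> has order \<open>2 ^ (n + 1)\<close>.\<close>
  have BL: "B (Suc k) \<in> L"
    unfolding B_def L_def division_field_def
    by (rule rat_adjoin_prod)
      (use G k in \<open>auto intro!: rat_adjoin_power simp: L_def division_field_def\<close>)
  have "\<zeta> ^ 2 ^ Suc n = 1" using assms(2) by (simp add: primitive_root_of_unity_def)
  then obtain j where "\<zeta> = B (Suc k) ^ j"
    using root_of_unity_is_power[OF B_order[of k], of \<zeta>] k by auto
  then have "\<zeta> \<in> L"
    using BL unfolding L_def division_field_def by (simp add: rat_adjoin_power)
  then show ?thesis
    unfolding L_def division_field_def by (intro rat_adjoin_least) simp
qed

end
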